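(* Let $K\subseteq[-1,1]$ be a set having $0$ as a limit point, let $\mathcal{A}$ be a C$^\ast$-algebra and let $\mathcal{I}$ be a closed ideal of $\mathcal{A}$. Then $\mathcal{A}[Z]/\mathcal{I}[Z]$, with the quotient norm $\|F+\mathcal{I}[Z]\|=\inf_{H\in\mathcal{I}[Z]}\|F+H\|_K$, is a pre-C$^\ast$-algebra.
   Context: All C$^\ast$-algebras are complex. For a C$^\ast$-algebra $\mathcal{A}$, $\mathcal{A}[Z]$ is the $\ast$-algebra of all formal power series $F(Z)=\sum_{n=0}^\infty a_nZ^n$ with $a_n\in\mathcal{A}$ and $\sum_{n=0}^\infty\|a_n\|<\infty$, with coefficientwise linear operations, Cauchy product, and involution $(\sum a_nZ^n)^\ast=\sum a_n^\ast Z^n$. For $t\in[-1,1]$, $F(t)=\sum_{n=0}^\infty a_nt^n\in\mathcal{A}$, and $\|F\|_K=\sup_{t\in K}\|F(t)\|$ is a norm on $\mathcal{A}[Z]$. For a closed ideal $\mathcal{I}$ of $\mathcal{A}$, $\mathcal{I}[Z]$ is a $\|\cdot\|_K$-closed two-sided $\ast$-ideal of $\mathcal{A}[Z]$. A pre-C$^\ast$-algebra is a normed $\ast$-algebra (not necessarily complete) whose norm satisfies $\|x^\ast x\|=\|x\|^2$ for all $x$. *)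

theory Defs
  imports
    "HOL-Analysis.Analysis"
    "HOL-Computational_Algebra.Formal_Power_Series"
    "HOL-Library.Set_Algebras"
begin

section \<open>C*-algebras\<close>

text \<open>
  Complex C*-algebras, not assumed to have a unit, as a type class. The superclasses contribute
  a complete submultiplicative norm; \<open>scaleC_of_real\<close> makes the complex scalar multiplication
  extend the real one.
\<close>

class cstar_algebra = real_normed_algebra + banach +
  fixes scaleC :: "complex \<Rightarrow> 'a \<Rightarrow> 'a"  (infixr \<open>*\<^sub>C\<close> 75)
    and star :: "'a \<Rightarrow> 'a"
  assumes scaleC_add_right: "c *\<^sub>C (x + y) = c *\<^sub>C x + c *\<^sub>C y"
    and scaleC_add_left: "(c + d) *\<^sub>C x = c *\<^sub>C x + d *\<^sub>C x"
    and scaleC_scaleC: "c *\<^sub>C (d *\<^sub>C x) = (c * d) *\<^sub>C x"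
    and scaleC_of_real: "complex_of_real r *\<^sub>C x = r *\<^sub>R x"
    and mult_scaleC_left: "(c *\<^sub>C x) * y = c *\<^sub>C (x * y)"
    and mult_scaleC_right: "x * (c *\<^sub>C y) = c *\<^sub>C (x * y)"
    and norm_scaleC: "norm (c *\<^sub>C x) = cmod c * norm x"
    and star_add: "star (x + y) = star x + star y"
    and star_scaleC: "star (c *\<^sub>C x) = cnj c *\<^sub>C star x"
    and star_mult: "star (x * y) = star y * star x"
    and star_star: "star (star x) = x"
    and norm_star_mult_self: "norm (star x * x) = (norm x)\<^sup>2"

text \<open>Two-sided; self-adjointness is not part of the definition.\<close>

definition closed_ideal :: "'a::cstar_algebra set \<Rightarrow> bool" where
  "closed_ideal I \<longleftrightarrow>
     closed I \<and> 0 \<in> I \<and> (\<forall>x\<in>I. \<forall>y\<in>I. x + y \<in> I) \<and> (\<forall>c. \<forall>x\<in>I. c *\<^sub>C x \<in> I) \<and>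
     (\<forall>a. \<forall>x\<in>I. a * x \<in> I \<and> x * a \<in> I)"


section \<open>Pre-C*-algebras\<close>

text \<open>
  Here the structure lives on an explicit carrier set, because the quotient below depends on an
  ideal and so is not a type.
\<close>

locale star_algebra_on =
  fixes C :: "'b set"
    and add :: "'b \<Rightarrow> 'b \<Rightarrow> 'b"
    and zero :: 'b
    and scale :: "complex \<Rightarrow> 'b \<Rightarrow> 'b"
    and mult :: "'b \<Rightarrow> 'b \<Rightarrow> 'b"
    and adj :: "'b \<Rightarrow> 'b"
  assumes add_closed: "\<lbrakk>x \<in> C; y \<in> C\<rbrakk> \<Longrightarrow> add x y \<in> C"
    and zero_closed: "zero \<in> C"
    and scale_closed: "x \<in> C \<Longrightarrow> scale c x \<in> C"
    and mult_closed: "\<lbrakk>x \<in> C; y \<in> C\<rbrakk> \<Longrightarrow> mult x y \<in> C"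
    and adj_closed: "x \<in> C \<Longrightarrow> adj x \<in> C"
    and add_assoc: "\<lbrakk>x \<in> C; y \<in> C; z \<in> C\<rbrakk> \<Longrightarrow> add (add x y) z = add x (add y z)"
    and add_commute: "\<lbrakk>x \<in> C; y \<in> C\<rbrakk> \<Longrightarrow> add x y = add y x"
    and add_zero: "x \<in> C \<Longrightarrow> add zero x = x"
    and add_inverse: "x \<in> C \<Longrightarrow> \<exists>y\<in>C. add x y = zero"
    and scale_add_right: "\<lbrakk>x \<in> C; y \<in> C\<rbrakk> \<Longrightarrow> scale c (add x y) = add (scale c x) (scale c y)"
    and scale_add_left: "x \<in> C \<Longrightarrow> scale (c + d) x = add (scale c x) (scale d x)"
    and scale_scale: "x \<in> C \<Longrightarrow> scale c (scale d x) = scale (c * d) x"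
    and scale_one: "x \<in> C \<Longrightarrow> scale 1 x = x"
    and mult_assoc: "\<lbrakk>x \<in> C; y \<in> C; z \<in> C\<rbrakk> \<Longrightarrow> mult (mult x y) z = mult x (mult y z)"
    and distrib_left: "\<lbrakk>x \<in> C; y \<in> C; z \<in> C\<rbrakk> \<Longrightarrow> mult x (add y z) = add (mult x y) (mult x z)"
    and distrib_right: "\<lbrakk>x \<in> C; y \<in> C; z \<in> C\<rbrakk> \<Longrightarrow> mult (add x y) z = add (mult x z) (mult y z)"
    and mult_scale_left: "\<lbrakk>x \<in> C; y \<in> C\<rbrakk> \<Longrightarrow> mult (scale c x) y = scale c (mult x y)"
    and mult_scale_right: "\<lbrakk>x \<in> C; y \<in> C\<rbrakk> \<Longrightarrow> mult x (scale c y) = scale c (mult x y)"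
    and adj_add: "\<lbrakk>x \<in> C; y \<in> C\<rbrakk> \<Longrightarrow> adj (add x y) = add (adj x) (adj y)"
    and adj_scale: "x \<in> C \<Longrightarrow> adj (scale c x) = scale (cnj c) (adj x)"
    and adj_mult: "\<lbrakk>x \<in> C; y \<in> C\<rbrakk> \<Longrightarrow> adj (mult x y) = mult (adj y) (adj x)"
    and adj_adj: "x \<in> C \<Longrightarrow> adj (adj x) = x"

text \<open>The involution is isometric as a consequence of \<open>nrm_mult\<close> and \<open>cstar_identity\<close>.\<close>

locale pre_cstar_algebra_on = star_algebra_on C add zero scale mult adj
  for C :: "'b set" and add zero scale mult adj +
  fixes nrm :: "'b \<Rightarrow> real"
  assumes nrm_nonneg: "x \<in> C \<Longrightarrow> 0 \<le> nrm x"
    and nrm_eq_zero: "x \<in> C \<Longrightarrow> nrm x = 0 \<longleftrightarrow> x = zero"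
    and nrm_triangle: "\<lbrakk>x \<in> C; y \<in> C\<rbrakk> \<Longrightarrow> nrm (add x y) \<le> nrm x + nrm y"
    and nrm_scale: "x \<in> C \<Longrightarrow> nrm (scale c x) = cmod c * nrm x"
    and nrm_mult: "\<lbrakk>x \<in> C; y \<in> C\<rbrakk> \<Longrightarrow> nrm (mult x y) \<le> nrm x * nrm y"
    and cstar_identity: "x \<in> C \<Longrightarrow> nrm (mult (adj x) x) = (nrm x)\<^sup>2"

lemma pre_cstar_algebra_on_UNIV:
  "pre_cstar_algebra_on (UNIV :: 'a::cstar_algebra set) (+) 0 (*\<^sub>C) (*) star norm"
proof (unfold_locales, goal_cases)
  case (9 x)
  then show ?case by (intro bexI[of _ "- x"]) auto
next
  case (13 x)
  then show ?case using scaleC_of_real[of 1 x] by simp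
qed (auto simp: algebra_simps scaleC_add_right scaleC_add_left scaleC_scaleC mult_scaleC_left
      mult_scaleC_right norm_scaleC star_add star_scaleC star_mult star_star norm_star_mult_self
      norm_triangle_ineq norm_mult_ineq)


section \<open>Absolutely summable power series\<close>

text \<open>
  \<open>abs_power_series I\<close> is $I[Z]$; in particular \<open>abs_power_series UNIV\<close> is $A[Z]$.
  Addition and the Cauchy product are those of type \<open>fps\<close>.
\<close>

definition abs_power_series :: "'a::cstar_algebra set \<Rightarrow> 'a fps set" where
  "abs_power_series I = {F. (\<forall>n. fps_nth F n \<in> I) \<and> summable (\<lambda>n. norm (fps_nth F n))}"

definition fps_scaleC :: "complex \<Rightarrow> 'a::cstar_algebra fps \<Rightarrow> 'a fps" where
  "fps_scaleC c F = Abs_fps (\<lambda>n. c *\<^sub>C fps_nth F n)"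

definition fps_star :: "'a::cstar_algebra fps \<Rightarrow> 'a fps" where
  "fps_star F = Abs_fps (\<lambda>n. star (fps_nth F n))"

definition fps_value :: "'a::cstar_algebra fps \<Rightarrow> real \<Rightarrow> 'a" where
  "fps_value F t = (\<Sum>n. t ^ n *\<^sub>R fps_nth F n)"

definition fps_norm_on :: "real set \<Rightarrow> 'a::cstar_algebra fps \<Rightarrow> real" where
  "fps_norm_on K F = (SUP t\<in>K. norm (fps_value F t))"


section \<open>Quotients\<close>

text \<open>
  \<open>x +o J\<close> is the coset of \<open>x\<close>. The operations on cosets take the union of the cosets obtained
  from all representatives; this union is a single coset exactly when the operation is
  independent of the representatives.
\<close>

definition quot_carrier :: "'b::plus set \<Rightarrow> 'b set \<Rightarrow> 'b set set" where
  "quot_carrier R J = (\<lambda>x. x +o J) ` R"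

definition quot_lift :: "'b::plus set \<Rightarrow> ('b \<Rightarrow> 'b) \<Rightarrow> 'b set \<Rightarrow> 'b set" where
  "quot_lift J f X = (\<Union>x\<in>X. f x +o J)"

definition quot_lift2 :: "'b::plus set \<Rightarrow> ('b \<Rightarrow> 'b \<Rightarrow> 'b) \<Rightarrow> 'b set \<Rightarrow> 'b set \<Rightarrow> 'b set" where
  "quot_lift2 J f X Y = (\<Union>x\<in>X. \<Union>y\<in>Y. f x y +o J)"

definition quot_norm :: "('b \<Rightarrow> real) \<Rightarrow> 'b set \<Rightarrow> real" where
  "quot_norm N X = (INF x\<in>X. N x)"

lemma quot_norm_coset: "quot_norm N (x +o J) = (INF h\<in>J. N (x + h))"
proof -
  have "x +o J = (\<lambda>h. x + h) ` J"
    by (auto simp: elt_set_plus_def)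
  then show ?thesis
    by (simp add: quot_norm_def image_image)
qed

end

theory Submission
  imports Defs
begin

text \<open>
  A closed ideal \<open>I\<close> contains approximate units \<open>e\<close> for which right multiplication by \<open>1 - e\<close> is a
  contraction. Hence \<open>I\<close> is self-adjoint, and for \<open>H\<close> in \<open>I[Z]\<close> one can make \<open>H(1 - e)\<close> small
  uniformly on \<open>[-1, 1]\<close>. The C*-identity in the algebra, evaluated pointwise, gives
  \<open>\<parallel>F(1 - e)\<parallel>\<^sup>2 \<le> \<parallel>F\<^sup>*F(1 - e)\<parallel> \<le> \<parallel>F\<^sup>*F + H\<parallel> + \<parallel>H(1 - e)\<parallel>\<close>, and this yields the
  C*-identity for the quotient norm. That norm is definite because the coefficients of a series
  whose values near \<open>0\<close> lie in \<open>I\<close> lie in \<open>I\<close> themselves.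

  Instead of the continuous functional calculus, the approximate units are Cesaro means of the
  powers of \<open>1 - b\<^sup>2\<close> for small self-adjoint \<open>b\<close> in \<open>I\<close>, which is a contraction because
  \<open>b \<plusminus> \<i>\<surd>(1 - b\<^sup>2)\<close> is unitary.
\<close>

section \<open>Contractive approximate units\<close>

lemma norm_star: "norm (star x) = norm (x::'a::cstar_algebra)"
proof -
  have le: "norm y \<le> norm (star y)" for y :: 'a
  proof (cases "norm y = 0")
    case False
    have "(norm y)\<^sup>2 \<le> norm (star y) * norm y"
      by (metis norm_star_mult_self norm_mult_ineq)
    then show ?thesis
      using False by (simp add: power2_eq_square)
  qed auto
  show ?thesis
    using le[of x] le[of "star x"] by (simp add: star_star)
qed

lemma scaleC_minus_one: "(-1) *\<^sub>C x = - (x::'a::cstar_algebra)"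
  using scaleC_of_real[of "-1" x] by simp

lemma scaleC_one: "1 *\<^sub>C x = (x::'a::cstar_algebra)"
  using scaleC_of_real[of 1 x] by simp

lemma star_scaleR: "star (r *\<^sub>R x) = r *\<^sub>R star (x::'a::cstar_algebra)"
  using star_scaleC[of "of_real r" x] by (simp add: scaleC_of_real)

lemma bounded_linear_star: "bounded_linear (star :: 'a::cstar_algebra \<Rightarrow> 'a)"
  by (rule bounded_linear_intro[where K=1]) (auto simp: star_add star_scaleR norm_star)

lemma bounded_linear_scaleC: "bounded_linear (\<lambda>x::'a::cstar_algebra. c *\<^sub>C x)"
proof (rule bounded_linear_intro[where K="cmod c"])
  fix r and x :: 'a
  show "c *\<^sub>C r *\<^sub>R x = r *\<^sub>R c *\<^sub>C x"
    by (simp flip: scaleC_of_real add: scaleC_scaleC mult.commute)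
qed (auto simp: scaleC_add_right norm_scaleC)

lemmas star_diff = linear_diff[OF bounded_linear.linear[OF bounded_linear_star]]
lemmas star_zero = linear_0[OF bounded_linear.linear[OF bounded_linear_star]]
lemmas star_sum = linear_sum[OF bounded_linear.linear[OF bounded_linear_star]]
lemmas scaleC_sum = linear_sum[OF bounded_linear.linear[OF bounded_linear_scaleC]]

lemma norm_mult_star_self: "norm (x * star x) = (norm (x::'a::cstar_algebra))\<^sup>2"
  using norm_star_mult_self[of "star x"] by (simp add: star_star norm_star)

text \<open>In the unitization, \<open>1 - r\<close> is a square root of \<open>1 - b\<^sup>2\<close>.\<close>

lemma ex_sqrt_one_minus_square:
  fixes b :: "'a::cstar_algebra"
  assumes "star b = b" "norm b \<le> 1/2"
  obtains r where "star r = r" "r * b = b * r" "b * b = r + r - r * r"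
proof -
  \<comment> \<open>The required equation says that \<open>r\<close> is the mean of b^2 and r^2,
    that is, a fixed point of \<open>?f\<close>. On the ball of radius 1/2 this map contracts by the
    factor 1/2, and the closed conditions in \<open>?S\<close> pass to the fixed point.\<close>
  let ?S = "{r. norm r \<le> 1/2 \<and> star r = r \<and> r * b = b * r}"
  let ?f = "\<lambda>r. (1/2) *\<^sub>R (b * b + r * r)"
  have cont: "continuous_on UNIV (star :: 'a \<Rightarrow> 'a)"
    by (rule linear_continuous_on[OF bounded_linear_star])
  have "closed ?S"
    by (intro closed_Collect_conj closed_Collect_le closed_Collect_eq continuous_intros cont)
  then have "complete ?S"
    by (simp add: complete_eq_closed)
  moreover have "?S \<noteq> {}"
    by (auto intro!: exI[of _ 0] simp: star_zero)
  moreover have "?f ` ?S \<subseteq> ?S"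
  proof clarify
    fix r assume r: "norm r \<le> 1/2" "star r = r" "r * b = b * r"
    have "norm (b * b) \<le> (1/2) * (1/2)" "norm (r * r) \<le> (1/2) * (1/2)"
      using r assms by (meson norm_mult_ineq mult_mono norm_ge_zero order_trans zero_le_divide_1_iff zero_le_numeral)+
    then have "norm (?f r) \<le> 1/2"
      using norm_triangle_ineq[of "b*b" "r*r"] by simp
    moreover have "star (?f r) = ?f r"
      using r assms by (simp add: star_scaleR star_add star_mult)
    moreover have "r * r * b = b * (r * r)"
      using r(3) by (metis mult.assoc)
    then have "?f r * b = b * ?f r"
      by (simp add: algebra_simps)
    ultimately show "norm (?f r) \<le> 1/2 \<and> star (?f r) = ?f r \<and> ?f r * b = b * ?f r"
      by blast
  qed
  moreover have "dist (?f r) (?f s) \<le> 1/2 * dist r s" if "r \<in> ?S" "s \<in> ?S" for r s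
  proof -
    have "?f r - ?f s = (1/2) *\<^sub>R (r * (r - s) + (r - s) * s)"
      by (simp add: algebra_simps)
    also have "norm \<dots> \<le> 1/2 * (norm r * norm (r - s) + norm (r - s) * norm s)"
      by (simp add: order_trans[OF norm_triangle_ineq] add_mono norm_mult_ineq)
    also have "\<dots> \<le> 1/2 * (1/2 * norm (r - s) + norm (r - s) * (1/2))"
      using that by (intro mult_left_mono add_mono mult_right_mono) auto
    finally show ?thesis
      by (simp add: dist_norm)
  qed
  ultimately obtain r where r: "r \<in> ?S" "?f r = r"
    using Banach_fix[of ?S "1/2" ?f] by auto
  have "b * b + r * r = 2 *\<^sub>R ?f r"
    by simp
  then have "b * b = r + r - r * r"
    unfolding r(2) by (simp add: scaleR_2 algebra_simps)
  with r that show ?thesis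
    by auto
qed

text \<open>Right multiplication by the unitaries \<open>b \<plusminus> \<i>(1 - r)\<close> is isometric, and \<open>1 - r\<close> is
  half of the difference of these unitaries, up to the factor \<open>\<i>\<close>.\<close>

lemma norm_diff_mult_square_le:
  fixes b x :: "'a::cstar_algebra"
  assumes "star b = b" "norm b \<le> 1/2"
  shows "norm (x - x * (b * b)) \<le> norm x"
proof -
  obtain r where r: "star r = r" "r * b = b * r" "b * b = r + r - r * r"
    using ex_sqrt_one_minus_square assms by blast
  have contr: "norm (y - y * r) \<le> norm y" for y
  proof -
    define p q where "p = y * b" and "q = y - y * r"
    have comm: "r * (b * z) = b * (r * z)" for z
      using r(2) by (metis mult.assoc)
    have bb: "b * (b * z) = r * z + r * z - r * (r * z)" for z
      using r(3) by (metis mult.assoc distrib_right left_diff_distrib)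
    have sp: "star p = b * star y" and sq: "star q = star y - r * star y"
      by (simp_all add: p_def q_def star_mult star_diff r assms)
    \<comment> \<open>The conditions leave only c = i and c = -i. The cross terms cancel because
      \<open>q * star p\<close> equals \<open>p * star q\<close>, and the squares add up to
      \<open>y * star y\<close> because b^2 + (1 - r)^2 = 1.\<close>
    have iso: "norm (p + c *\<^sub>C q) = norm y" if "c * cnj c = 1" "cnj c = - c" for c
    proof -
      have "q * star p = p * star q"
        by (simp add: sp sq) (simp add: p_def q_def algebra_simps comm)
      moreover have "p * star p + q * star q = y * star y"
        by (simp add: sp sq) (simp add: p_def q_def algebra_simps bb)
      moreover have "(p + c *\<^sub>C q) * star (p + c *\<^sub>C q)
          = (p * star p + (c * cnj c) *\<^sub>C (q * star q)) + (c *\<^sub>C (q * star p) + cnj c *\<^sub>C (p * star q))"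
        by (simp add: star_add star_scaleC distrib_left distrib_right mult_scaleC_left
            mult_scaleC_right scaleC_scaleC scaleC_add_right add_ac mult.commute[of c])
      moreover have "c *\<^sub>C z + cnj c *\<^sub>C z = 0" for z :: 'a
        using that(2) scaleC_of_real[of 0 z] by (simp flip: scaleC_add_left)
      moreover have "1 *\<^sub>C z = z" for z :: 'a
        by (rule scaleC_one)
      ultimately have "(p + c *\<^sub>C q) * star (p + c *\<^sub>C q) = y * star y"
        using that by simp
      then have "(norm (p + c *\<^sub>C q))\<^sup>2 = (norm y)\<^sup>2"
        by (metis norm_mult_star_self)
      then show ?thesis
        by simp
    qed
    have "(p + \<i> *\<^sub>C q) - (p + (-\<i>) *\<^sub>C q) = (2 * \<i>) *\<^sub>C q"
    proof -
      have "(-\<i>) *\<^sub>C q = - (\<i> *\<^sub>C q)"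
        by (metis mult_minus1 scaleC_minus_one scaleC_scaleC)
      moreover have "(2 * \<i>) *\<^sub>C q = \<i> *\<^sub>C q + \<i> *\<^sub>C q"
        by (metis mult_2 scaleC_add_left)
      ultimately show ?thesis
        by simp
    qed
    then have "2 * norm q \<le> norm y + norm y"
      using norm_triangle_ineq4[of "p + \<i> *\<^sub>C q" "p + (-\<i>) *\<^sub>C q"]
      by (simp add: iso norm_scaleC norm_mult)
    then show ?thesis
      by (simp add: q_def)
  qed
  \<comment> \<open>As 1 - b^2 = (1 - r)^2, the contraction by 1 - r is applied twice.\<close>
  have eq: "x - x * (b * b) = (x - x * r) - (x - x * r) * r"
    by (simp add: r(3) algebra_simps)
  show ?thesis
    unfolding eq by (rule order_trans[OF contr contr])
qed

section \<open>Arithmetic in closed ideals\<close>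

lemma closed_idealD:
  assumes "closed_ideal I"
  shows "closed I" "0 \<in> I" "x \<in> I \<Longrightarrow> y \<in> I \<Longrightarrow> x + y \<in> I" "x \<in> I \<Longrightarrow> c *\<^sub>C x \<in> I"
    "x \<in> I \<Longrightarrow> a * x \<in> I" "x \<in> I \<Longrightarrow> x * a \<in> I"
  using assms by (auto simp: closed_ideal_def)

lemma closed_ideal_scaleR: "closed_ideal I \<Longrightarrow> x \<in> I \<Longrightarrow> r *\<^sub>R x \<in> I"
  by (metis closed_idealD(4) scaleC_of_real)

lemma closed_ideal_diff: "closed_ideal I \<Longrightarrow> x \<in> I \<Longrightarrow> y \<in> I \<Longrightarrow> x - y \<in> I"
  using closed_idealD(3)[of I x "(-1) *\<^sub>R y"] closed_ideal_scaleR[of I y "-1"] by simp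

lemma closed_ideal_sum: "closed_ideal I \<Longrightarrow> (\<And>k. k \<in> A \<Longrightarrow> f k \<in> I) \<Longrightarrow> sum f A \<in> I"
  by (induction A rule: infinite_finite_induct) (auto intro: closed_idealD)

text \<open>Passing to adjoints turns estimates for right multiplication by 1 - e into estimates for
  left multiplication.\<close>

lemma norm_star_diff_mult: "norm (star x - e * star x) = norm (x - x * star (e::'a::cstar_algebra))"
  using norm_star[of "x - x * star e"] by (simp add: star_diff star_mult star_star)

text \<open>In the unitization, \<open>1 - f k\<close> is the power \<open>(1 - b\<^sup>2)\<^sup>k\<close> and \<open>1 - e\<close> is the mean of the
  first \<open>N\<close> of these powers; the sum of \<open>b\<^sup>2 (1 - f k)\<close> telescopes.\<close>

lemma ex_mean_ergodic_element:
  fixes b :: "'a::cstar_algebra"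
  assumes I: "closed_ideal I" and b: "b \<in> I" "star b = b" "norm b \<le> 1/2" and N: "0 < N"
  obtains e where "e \<in> I" "star e = e" "\<And>x. norm (x - x * e) \<le> norm x"
    "norm (b * b - b * b * e) \<le> 2 / real N"
proof -
  define f :: "nat \<Rightarrow> 'a" where "f = rec_nat 0 (\<lambda>_ u. u + b * b - b * b * u)"
  have f0: "f 0 = 0" and fS: "f (Suc k) = f k + b * b - b * b * f k" for k
    by (simp_all add: f_def)
  have fI: "f k \<in> I" for k
    by (induction k) (auto simp: f0 fS I b intro!: closed_idealD[OF I] closed_ideal_diff[OF I])
  have comm: "f k * (b * b) = b * b * f k" for k
    by (induction k) (simp_all add: f0 fS algebra_simps)
  have fs: "star (f k) = f k" for k
  proof (induction k)
    case (Suc k)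
    then show ?case
      using comm[of k] by (simp add: fS star_add star_diff star_mult b)
  qed (simp add: f0 star_zero)
  have contr: "norm (x - x * f k) \<le> norm x" for x k
  proof (induction k)
    case (Suc k)
    have eq: "x - x * f (Suc k) = (x - x * f k) - (x - x * f k) * (b * b)"
      using comm[of k] by (simp add: fS algebra_simps)
    show ?case
      unfolding eq by (rule order_trans[OF norm_diff_mult_square_le[OF b(2,3)] Suc])
  qed (simp add: f0)
  \<comment> \<open>Since \<open>f k\<close> is self-adjoint, its squared norm is the norm of
    \<open>f k * f k\<close>. This differs from \<open>f k\<close> by
    \<open>f k - f k * f k\<close>, whose norm the contraction bounds by that of
    \<open>f k\<close>.\<close>
  have bound: "norm (f k) \<le> 2"
    for k
  proof -
    have "norm (f k) * norm (f k) = norm (f k * f k)"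
      using norm_star_mult_self[of "f k"] by (simp add: fs power2_eq_square)
    also have "\<dots> \<le> norm (f k) + norm (f k - f k * f k)"
      using norm_triangle_ineq4[of "f k" "f k - f k * f k"] by simp
    also have "\<dots> \<le> 2 * norm (f k)"
      using contr[of "f k" k] by simp
    finally show ?thesis
      by (cases "norm (f k) = 0") auto
  qed
  define e where "e = (1 / real N) *\<^sub>R (\<Sum>k<N. f k)"
  have mean: "x - x * e = (1 / real N) *\<^sub>R (\<Sum>k<N. x - x * f k)" for x
    using N by (simp add: e_def sum_subtractf sum_distrib_left scaleR_diff_right
        sum_constant_scaleR)
  show thesis
  proof
    show "e \<in> I"
      unfolding e_def by (intro closed_ideal_scaleR closed_ideal_sum I fI)
    show "star e = e"
      by (simp add: e_def star_scaleR star_sum fs)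
    show "norm (x - x * e) \<le> norm x" for x
    proof -
      have "norm (\<Sum>k<N. x - x * f k) \<le> real N * norm x"
        using sum_norm_le[of "{..<N}" "\<lambda>k. x - x * f k" "\<lambda>_. norm x"] contr by simp
      then show ?thesis
        using N by (simp add: mean field_simps)
    qed
    have "(\<Sum>k<N. b * b - b * b * f k) = (\<Sum>k<N. f (Suc k) - f k)"
      by (simp add: fS)
    also have "\<dots> = f N"
      by (simp add: sum_lessThan_telescope f0)
    finally have "b * b - b * b * e = (1 / real N) *\<^sub>R f N"
      by (simp add: mean)
    then show "norm (b * b - b * b * e) \<le> 2 / real N"
      using N bound[of N] by (simp add: divide_right_mono)
  qed
qed

text \<open>The C*-identity turns the left side into the norm of (1 - star e) z, where z is the
  element on the right. Left multiplication by 1 - star e is again a contraction, by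
  adjoints.\<close>

lemma norm_sandwich_le:
  fixes e y :: "'a::cstar_algebra"
  assumes "\<And>x. norm (x - x * e) \<le> norm x"
  shows "(norm (y - y * e))\<^sup>2 \<le> norm (star y * y - star y * y * e)"
proof -
  let ?z = "star y * y - star y * y * e"
  have "star (y - y * e) * (y - y * e) = ?z - star e * ?z"
    by (simp add: star_diff star_mult algebra_simps)
  then have "(norm (y - y * e))\<^sup>2 = norm (?z - star e * ?z)"
    by (metis norm_star_mult_self)
  also have "\<dots> \<le> norm ?z"
    using norm_star_diff_mult[of "star ?z" "star e"] assms[of "star ?z"]
    by (simp add: star_star norm_star)
  finally show ?thesis .
qed

text \<open>The sandwich estimate is used twice: it reduces \<open>h\<close> to a multiple
  \<open>b\<close> of \<open>star h * h\<close>, and then \<open>b\<close> to b^2, for which the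
  mean ergodic element is small.\<close>

lemma approximate_unit_single:
  fixes h :: "'a::cstar_algebra"
  assumes I: "closed_ideal I" and h: "h \<in> I" and eps: "0 < \<epsilon>"
  obtains e where "e \<in> I" "star e = e" "\<And>x. norm (x - x * e) \<le> norm x" "norm (h - h * e) < \<epsilon>"
proof -
  \<comment> \<open>This scales \<open>star h * h\<close> to norm at most 1/2 and stays positive for
    h = 0.\<close>
  define c where "c = 1 / (1 + 2 * norm (star h * h))"
  define b where "b = c *\<^sub>R (star h * h)"
  have c: "0 < c"
    by (simp add: c_def add_pos_nonneg)
  have b: "b \<in> I" "star b = b" "norm b \<le> 1/2"
  proof -
    show "b \<in> I"
      unfolding b_def by (intro closed_ideal_scaleR closed_idealD(5)) (use I h in auto)
    show "star b = b"
      by (simp add: b_def star_scaleR star_mult star_star)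
    show "norm b \<le> 1/2"
      using c by (simp add: b_def c_def field_simps add_pos_nonneg)
  qed
  \<comment> \<open>Each use of the sandwich estimate costs a square root, hence the fourth power of
    \<open>\<epsilon>\<close>; the factor c^2 undoes the scaling.\<close>
  obtain N :: nat where N: "2 / (c\<^sup>2 * \<epsilon> ^ 4) < real N"
    using reals_Archimedean2 by blast
  have "0 < 2 / (c\<^sup>2 * \<epsilon> ^ 4)"
    using c eps by simp
  with N have Npos: "0 < N"
    by (cases N) auto
  obtain e where e: "e \<in> I" "star e = e" "\<And>x. norm (x - x * e) \<le> norm x"
    "norm (b * b - b * b * e) \<le> 2 / real N"
    using ex_mean_ergodic_element[OF I b Npos] by blast
  have "c * (norm (h - h * e))\<^sup>2 \<le> c * norm (star h * h - star h * h * e)"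
    using norm_sandwich_le[OF e(3), of h] c by simp
  also have "\<dots> = norm (b - b * e)"
    using c by (simp add: b_def flip: scaleR_diff_right)
  finally have "(c * (norm (h - h * e))\<^sup>2)\<^sup>2 \<le> (norm (b - b * e))\<^sup>2"
    using c by (intro power_mono) auto
  also have "\<dots> \<le> 2 / real N"
    using norm_sandwich_le[OF e(3), of b] e(4) b(2) by simp
  also have "\<dots> < c\<^sup>2 * \<epsilon> ^ 4"
    using N Npos c eps by (simp add: field_simps)
  finally have "norm (h - h * e) ^ 4 < \<epsilon> ^ 4"
    using c by (simp add: power_mult_distrib flip: power_mult)
  then have "norm (h - h * e) < \<epsilon>"
    using eps by (meson less_imp_le power_less_imp_less_base)
  with e that show thesis
    by blast
qed

text \<open>The elements \<open>e * star h\<close> lie in \<open>I\<close> because \<open>e\<close>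
  does, and they tend to \<open>star h\<close> because \<open>h * e\<close> tends to
  \<open>h\<close>.\<close>

lemma closed_ideal_star:
  assumes I: "closed_ideal I" and h: "h \<in> I"
  shows "star h \<in> I"
proof -
  have "star h \<in> closure I"
    unfolding closure_approachable
  proof (intro allI impI)
    fix \<epsilon> :: real assume "0 < \<epsilon>"
    then obtain e where "e \<in> I" "star e = e" "norm (h - h * e) < \<epsilon>"
      using approximate_unit_single[OF I h] by blast
    then show "\<exists>y\<in>I. dist y (star h) < \<epsilon>"
      using norm_star_diff_mult[of h e] closed_idealD(6)[OF I]
      by (intro bexI[of _ "e * star h"]) (auto simp: dist_norm norm_minus_commute)
  qed
  then show ?thesis
    using closed_idealD(1)[OF I] by (simp add: closure_closed)
qed

text \<open>The factors \<open>1 - e\<close> for the single elements are multiplied together, so no order structure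
  on the algebra is needed.\<close>

lemma approximate_unit_finite:
  fixes H :: "'a::cstar_algebra set"
  assumes I: "closed_ideal I" and "finite H" "H \<subseteq> I" and eps: "0 < \<epsilon>"
  obtains e where "e \<in> I" "\<And>x. norm (x - x * e) \<le> norm x" "\<And>h. h \<in> H \<Longrightarrow> norm (h - h * e) < \<epsilon>"
proof -
  have "\<exists>e\<in>I. (\<forall>x. norm (x - x * e) \<le> norm x) \<and> (\<forall>h\<in>H. norm (h - h * e) < \<epsilon>)"
    using assms(2,3)
  proof (induction H)
    case empty
    then show ?case
      using closed_idealD(2)[OF I] by (intro bexI[of _ 0]) auto
  next
    case (insert g H)
    then obtain e where e: "e \<in> I" "\<And>x. norm (x - x * e) \<le> norm x" "\<And>h. h \<in> H \<Longrightarrow> norm (h - h * e) < \<epsilon>"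
      by auto
    have "g - g * e \<in> I"
      using insert.prems e(1) by (intro closed_ideal_diff closed_idealD(5)) (use I in auto)
    then obtain e' where e': "e' \<in> I" "\<And>x. norm (x - x * e') \<le> norm x"
      "norm ((g - g * e) - (g - g * e) * e') < \<epsilon>"
      using approximate_unit_single[OF I _ eps] by blast
    \<comment> \<open>This is the element with 1 - u = (1 - e)(1 - e'). The factor 1 - e' comes last
      and is a contraction, so the estimates on \<open>H\<close> survive; \<open>e'\<close> was
      chosen for \<open>g - g * e\<close> to take care of \<open>g\<close>.\<close>
    let ?u = "e + e' - e * e'"
    have u: "x - x * ?u = (x - x * e) - (x - x * e) * e'" for x
      by (simp add: algebra_simps)
    have "norm (x - x * ?u) \<le> norm (x - x * e)" for x
      unfolding u by (rule e'(2))
    moreover have "?u \<in> I"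
      using e(1) e'(1) by (intro closed_ideal_diff closed_idealD(3,5)) (use I in auto)
    moreover have "norm (g - g * ?u) < \<epsilon>"
      unfolding u by (rule e'(3))
    ultimately show ?case
      using e(2,3) by (intro bexI[of _ ?u]) (auto intro: order_trans le_less_trans)
  qed
  with that show thesis
    by blast
qed

section \<open>Quotients by star ideals\<close>

text \<open>The last assumption is independence of representatives; it collapses the union over the
  coset to one coset and so allows computing with a single representative.\<close>

lemma quot_lift_coset:
  fixes J :: "'b::ring set"
  assumes "0 \<in> J" "\<And>h k. h \<in> J \<Longrightarrow> k \<in> J \<Longrightarrow> h + k \<in> J"
    and "\<And>h. h \<in> J \<Longrightarrow> f (x + h) - f x \<in> J"
  shows "quot_lift J f (x +o J) = f x +o J"
proof (intro equalityI subsetI)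
  fix z assume "z \<in> quot_lift J f (x +o J)"
  then obtain h k where "h \<in> J" "k \<in> J" "z = f (x + h) + k"
    by (auto simp: quot_lift_def elt_set_plus_def)
  then show "z \<in> f x +o J"
    using assms(2)[OF assms(3)[of h], of k]
    by (auto simp: elt_set_plus_def intro!: bexI[of _ "f (x + h) - f x + k"])
qed (use assms(1) in \<open>force simp: quot_lift_def elt_set_plus_def\<close>)

lemma quot_lift2_coset:
  fixes J :: "'b::ring set"
  assumes "0 \<in> J" "\<And>h k. h \<in> J \<Longrightarrow> k \<in> J \<Longrightarrow> h + k \<in> J"
    and "\<And>h k. h \<in> J \<Longrightarrow> k \<in> J \<Longrightarrow> f (x + h) (y + k) - f x y \<in> J"
  shows "quot_lift2 J f (x +o J) (y +o J) = f x y +o J"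
proof (intro equalityI subsetI)
  fix z assume "z \<in> quot_lift2 J f (x +o J) (y +o J)"
  then obtain h k l where "h \<in> J" "k \<in> J" "l \<in> J" "z = f (x + h) (y + k) + l"
    by (auto simp: quot_lift2_def elt_set_plus_def)
  then show "z \<in> f x y +o J"
    using assms(2)[OF assms(3)[of h k], of l]
    by (auto simp: elt_set_plus_def intro!: bexI[of _ "f (x + h) (y + k) - f x y + l"])
next
  fix z assume z: "z \<in> f x y +o J"
  have "x \<in> x +o J" "y \<in> y +o J"
    using assms(1) by (auto simp: elt_set_plus_def intro: bexI[of _ 0])
  with z show "z \<in> quot_lift2 J f (x +o J) (y +o J)"
    unfolding quot_lift2_def by blast
qed

text \<open>The carrier is a subset of a ring type, because formal series form such a type while
  only the absolutely summable ones belong to the algebra.\<close>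

locale star_ideal_on = star_algebra_on R "(+)" 0 scale "(*)" adj
  for R :: "'b::ring set" and scale adj +
  fixes J :: "'b set"
  assumes ideal_subset: "J \<subseteq> R"
    and ideal_zero: "0 \<in> J"
    and ideal_add: "\<lbrakk>x \<in> J; y \<in> J\<rbrakk> \<Longrightarrow> x + y \<in> J"
    and ideal_scale: "x \<in> J \<Longrightarrow> scale c x \<in> J"
    and ideal_mult_left: "\<lbrakk>r \<in> R; x \<in> J\<rbrakk> \<Longrightarrow> r * x \<in> J"
    and ideal_mult_right: "\<lbrakk>r \<in> R; x \<in> J\<rbrakk> \<Longrightarrow> x * r \<in> J"
    and ideal_adj: "x \<in> J \<Longrightarrow> adj x \<in> J"
begin

lemma in_carrier: "x \<in> J \<Longrightarrow> x \<in> R"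
  using ideal_subset by blast

lemma add_ideal_closed: "x \<in> R \<Longrightarrow> h \<in> J \<Longrightarrow> x + h \<in> R"
  by (simp add: add_closed in_carrier)

lemma scale_zero: "x \<in> R \<Longrightarrow> scale 0 x = 0"
  using scale_add_left[of x 0 0] by simp

lemma scale_minus_one: "x \<in> R \<Longrightarrow> scale (-1) x = - x"
  using scale_add_left[of x 1 "-1"] by (simp add: scale_one scale_zero minus_unique)

lemma ideal_uminus: "x \<in> J \<Longrightarrow> - x \<in> J"
  using ideal_scale[of x "-1"] by (simp add: scale_minus_one in_carrier)

lemma ideal_coset: "0 +o J = J"
  by (auto simp: elt_set_plus_def)

lemma coset_eq_ideal: "x +o J = J \<longleftrightarrow> x \<in> J"
proof
  assume "x +o J = J"
  moreover have "x \<in> x +o J"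
    using ideal_zero by (auto simp: elt_set_plus_def intro: bexI[of _ 0])
  ultimately show "x \<in> J"
    by simp
next
  assume x: "x \<in> J"
  have "h \<in> x +o J" if "h \<in> J" for h
    using ideal_add[OF that ideal_uminus[OF x]]
    by (auto simp: elt_set_plus_def intro!: bexI[of _ "h + - x"])
  then show "x +o J = J"
    using x ideal_add by (auto simp: elt_set_plus_def)
qed

lemma add_coset: "quot_lift2 J (+) (x +o J) (y +o J) = (x + y) +o J"
  by (rule quot_lift2_coset) (auto simp: ideal_zero ideal_add)

lemma mult_coset:
  assumes "x \<in> R" "y \<in> R"
  shows "quot_lift2 J (*) (x +o J) (y +o J) = (x * y) +o J"
proof (rule quot_lift2_coset[OF ideal_zero ideal_add])
  fix h k assume "h \<in> J" "k \<in> J"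
  moreover have "(x + h) * (y + k) - x * y = x * k + h * y + h * k"
    by (simp add: algebra_simps)
  ultimately show "(x + h) * (y + k) - x * y \<in> J"
    using assms by (simp add: ideal_add ideal_mult_left ideal_mult_right in_carrier)
qed

lemma scale_coset: "x \<in> R \<Longrightarrow> quot_lift J (scale c) (x +o J) = scale c x +o J"
  by (rule quot_lift_coset[OF ideal_zero ideal_add])
    (auto simp: scale_add_right in_carrier ideal_scale)

lemma adj_coset: "x \<in> R \<Longrightarrow> quot_lift J adj (x +o J) = adj x +o J"
  by (rule quot_lift_coset[OF ideal_zero ideal_add]) (auto simp: adj_add in_carrier ideal_adj)

lemma coset_in_quot_carrier: "x \<in> R \<Longrightarrow> x +o J \<in> quot_carrier R J"
  by (simp add: quot_carrier_def)

lemma quot_carrierE: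
  assumes "X \<in> quot_carrier R J"
  obtains x where "x \<in> R" "X = x +o J"
  using assms by (auto simp: quot_carrier_def)

lemmas coset_simps = add_coset mult_coset scale_coset adj_coset
lemmas carrier_closed = add_closed mult_closed scale_closed adj_closed

lemma star_algebra_on_quotient:
  "star_algebra_on (quot_carrier R J) (quot_lift2 J (+)) J (\<lambda>c. quot_lift J (scale c))
     (quot_lift2 J (*)) (quot_lift J adj)"
proof (unfold_locales, goal_cases)
  case 2
  show ?case
    using coset_in_quot_carrier[OF zero_closed] by (simp add: ideal_coset)
next
  case (8 X)
  then obtain x where "x \<in> R" "X = x +o J"
    by (auto elim: quot_carrierE)
  then show ?case
    using add_coset[of 0 x] by (simp add: ideal_coset)
next
  case (9 X)
  then obtain x where "x \<in> R" "X = x +o J"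
    by (auto elim: quot_carrierE)
  then show ?case
    using add_coset[of x "- x"] scale_closed[of x "-1"]
    by (intro bexI[of _ "- x +o J"]) (auto simp: scale_minus_one ideal_coset coset_in_quot_carrier)
qed (auto elim!: quot_carrierE intro!: coset_in_quot_carrier arg_cong[where f="\<lambda>x. x +o J"]
    simp: coset_simps carrier_closed scale_one scale_scale scale_add_right scale_add_left
      mult_scale_left mult_scale_right adj_add adj_scale adj_mult adj_adj algebra_simps)

end

text \<open>This isolates the analytic input. \<open>ideal_closed\<close> makes the quotient norm
  definite, and \<open>approximate_cstar\<close> gives the hard half of its C*-identity.\<close>

locale cstar_seminorm_ideal = star_ideal_on R scale adj J
  for R :: "'b::ring set" and scale adj J +
  fixes N :: "'b \<Rightarrow> real"
  assumes N_nonneg: "x \<in> R \<Longrightarrow> 0 \<le> N x"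
    and N_triangle: "\<lbrakk>x \<in> R; y \<in> R\<rbrakk> \<Longrightarrow> N (x + y) \<le> N x + N y"
    and N_scale: "x \<in> R \<Longrightarrow> N (scale c x) = cmod c * N x"
    and N_mult: "\<lbrakk>x \<in> R; y \<in> R\<rbrakk> \<Longrightarrow> N (x * y) \<le> N x * N y"
    and N_adj: "x \<in> R \<Longrightarrow> N (adj x) = N x"
    and ideal_closed: "\<lbrakk>x \<in> R; \<And>\<epsilon>. 0 < \<epsilon> \<Longrightarrow> \<exists>h\<in>J. N (x + h) < \<epsilon>\<rbrakk> \<Longrightarrow> x \<in> J"
    and approximate_cstar: "\<lbrakk>x \<in> R; h \<in> J; 0 < \<epsilon>\<rbrakk> \<Longrightarrow>
      \<exists>k\<in>J. (N (x + k))\<^sup>2 \<le> N (adj x * x + h) + \<epsilon>"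
begin

text \<open>The quotient norm as a function of a representative, so that estimates take place in
  \<open>R\<close> instead of on cosets.\<close>

definition qn :: "'b \<Rightarrow> real" where "qn x = quot_norm N (x +o J)"

lemma qn_le: "x \<in> R \<Longrightarrow> h \<in> J \<Longrightarrow> qn x \<le> N (x + h)"
  unfolding qn_def quot_norm_coset
  by (rule cINF_lower) (auto intro!: bdd_belowI[of _ 0] N_nonneg add_ideal_closed)

lemma le_qn: "(\<And>h. h \<in> J \<Longrightarrow> c \<le> N (x + h)) \<Longrightarrow> c \<le> qn x"
  unfolding qn_def quot_norm_coset using ideal_zero by (intro cINF_greatest) auto

lemma qn_approx:
  assumes "qn x < c"
  obtains h where "h \<in> J" "N (x + h) < c"
  using le_qn[of c x] assms by (meson not_le)

lemma qn_nonneg: "x \<in> R \<Longrightarrow> 0 \<le> qn x"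
  by (rule le_qn) (auto intro: N_nonneg add_ideal_closed)

lemma qn_eq_zero:
  assumes x: "x \<in> R"
  shows "qn x = 0 \<longleftrightarrow> x \<in> J"
proof
  assume "qn x = 0"
  then show "x \<in> J"
    by (intro ideal_closed x) (metis qn_approx)
next
  assume "x \<in> J"
  then have "qn x \<le> N 0"
    using qn_le[OF x ideal_uminus, of x] by simp
  also have "N 0 = 0"
    using N_scale[OF zero_closed, of 0] by (simp add: scale_zero zero_closed)
  finally show "qn x = 0"
    using qn_nonneg[OF x] by simp
qed

lemma qn_triangle:
  assumes "x \<in> R" "y \<in> R"
  shows "qn (x + y) \<le> qn x + qn y"
proof (rule field_le_epsilon)
  fix \<epsilon> :: real assume \<epsilon>: "0 < \<epsilon>"
  obtain h where h: "h \<in> J" "N (x + h) < qn x + \<epsilon>/2"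
    using qn_approx[of x "qn x + \<epsilon>/2"] \<epsilon> by auto
  obtain k where k: "k \<in> J" "N (y + k) < qn y + \<epsilon>/2"
    using qn_approx[of y "qn y + \<epsilon>/2"] \<epsilon> by auto
  have "qn (x + y) \<le> N ((x + y) + (h + k))"
    using assms h k by (intro qn_le add_closed ideal_add)
  also have "(x + y) + (h + k) = (x + h) + (y + k)"
    by simp
  also have "N \<dots> \<le> N (x + h) + N (y + k)"
    using assms h k by (intro N_triangle add_ideal_closed)
  finally show "qn (x + y) \<le> qn x + qn y + \<epsilon>"
    using h k by simp
qed

lemma qn_mult:
  assumes "x \<in> R" "y \<in> R"
  shows "qn (x * y) \<le> qn x * qn y"
proof -
  have le: "qn (x * y) \<le> N (x + h) * N (y + k)" if "h \<in> J" "k \<in> J" for h k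
  proof -
    have "qn (x * y) \<le> N (x * y + (x * k + h * y + h * k))"
      using assms that by (intro qn_le mult_closed ideal_add ideal_mult_left ideal_mult_right) (auto simp: in_carrier)
    also have "x * y + (x * k + h * y + h * k) = (x + h) * (y + k)"
      by (simp add: algebra_simps)
    also have "N \<dots> \<le> N (x + h) * N (y + k)"
      using assms that by (intro N_mult add_ideal_closed)
    finally show ?thesis .
  qed
  \<comment> \<open>Near-optimal representatives with errors 1/(n+1) are used, since the error of a
    product also involves the factors; letting n grow removes it.\<close>
  have approach: "\<exists>h. \<forall>n. h n \<in> J \<and> N (z + h n) < qn z + 1 / real (Suc n)" for z
    by (intro choice allI) (metis qn_approx less_add_same_cancel1 of_nat_0_less_iff zero_less_Suc zero_less_divide_1_iff)
  obtain h where h: "\<And>n. h n \<in> J \<and> N (x + h n) < qn x + 1 / real (Suc n)"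
    using approach by blast
  obtain k where k: "\<And>n. k n \<in> J \<and> N (y + k n) < qn y + 1 / real (Suc n)"
    using approach by blast
  have lim: "(\<lambda>n. (qn x + 1 / real (Suc n)) * (qn y + 1 / real (Suc n))) \<longlonglongrightarrow> (qn x + 0) * (qn y + 0)"
    by (intro tendsto_intros LIMSEQ_Suc lim_1_over_n)
  have "qn (x * y) \<le> (qn x + 1 / real (Suc n)) * (qn y + 1 / real (Suc n))" for n
  proof -
    have "N (x + h n) * N (y + k n) \<le> (qn x + 1 / real (Suc n)) * (qn y + 1 / real (Suc n))"
      using h[of n] k[of n] assms
      by (intro mult_mono) (auto intro!: N_nonneg add_ideal_closed add_nonneg_nonneg qn_nonneg)
    then show ?thesis
      using le[of "h n" "k n"] h k by (meson order_trans)
  qed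
  then show ?thesis
    using LIMSEQ_le_const[OF lim] by simp
qed

lemma qn_scale_le:
  assumes x: "x \<in> R"
  shows "qn (scale c x) \<le> cmod c * qn x"
proof (cases "c = 0")
  case True
  then show ?thesis
    using qn_eq_zero[of 0] x by (simp add: scale_zero zero_closed ideal_zero)
next
  case False
  have "qn (scale c x) / cmod c \<le> qn x"
  proof (rule le_qn)
    fix h assume h: "h \<in> J"
    have "qn (scale c x) \<le> N (scale c (x + h))"
      using qn_le[of "scale c x" "scale c h"] x h
      by (simp add: scale_add_right scale_closed ideal_scale in_carrier)
    then show "qn (scale c x) / cmod c \<le> N (x + h)"
      using False x h by (simp add: N_scale add_closed in_carrier field_simps)
  qed
  then show ?thesis
    using False by (simp add: field_simps)
qed

text \<open>For nonzero c the reverse inequality is \<open>qn_scale_le\<close> for the inverse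
  scalar.\<close>

lemma qn_scale:
  assumes x: "x \<in> R"
  shows "qn (scale c x) = cmod c * qn x"
proof (cases "c = 0")
  case True
  then show ?thesis
    using qn_scale_le[of x c] qn_nonneg[of "scale c x"] x by (simp add: scale_closed)
next
  case False
  have "qn x = qn (scale (inverse c) (scale c x))"
    using False x by (simp add: scale_scale scale_one)
  also have "\<dots> \<le> cmod (inverse c) * qn (scale c x)"
    using x by (intro qn_scale_le scale_closed)
  also have "\<dots> = qn (scale c x) / cmod c"
    by (simp add: norm_inverse divide_inverse mult.commute)
  finally have "cmod c * qn x \<le> qn (scale c x)"
    using False by (simp add: pos_le_divide_eq mult.commute)
  then show ?thesis
    using qn_scale_le[OF x, of c] by simp
qed

lemma qn_adj_le:
  assumes x: "x \<in> R"
  shows "qn (adj x) \<le> qn x"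
proof (rule le_qn)
  fix h assume h: "h \<in> J"
  have "qn (adj x) \<le> N (adj (x + h))"
    using qn_le[of "adj x" "adj h"] x h by (simp add: adj_add adj_closed ideal_adj in_carrier)
  then show "qn (adj x) \<le> N (x + h)"
    using x h by (simp add: N_adj add_closed in_carrier)
qed

text \<open>One half is submultiplicativity together with \<open>qn_adj_le\<close>. For the other,
  \<open>approximate_cstar\<close> compares every representative of the coset of
  \<open>adj x * x\<close> with the square of some representative norm of x.\<close>

lemma qn_cstar:
  assumes x: "x \<in> R"
  shows "qn (adj x * x) = (qn x)\<^sup>2"
proof (rule antisym)
  have "qn (adj x * x) \<le> qn (adj x) * qn x"
    using x by (intro qn_mult adj_closed)
  also have "\<dots> \<le> qn x * qn x"
    using x by (intro mult_right_mono qn_adj_le qn_nonneg)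
  finally show "qn (adj x * x) \<le> (qn x)\<^sup>2"
    by (simp add: power2_eq_square)
  show "(qn x)\<^sup>2 \<le> qn (adj x * x)"
  proof (rule le_qn, rule field_le_epsilon)
    fix h and \<epsilon> :: real assume "h \<in> J" "0 < \<epsilon>"
    then obtain k where k: "k \<in> J" "(N (x + k))\<^sup>2 \<le> N (adj x * x + h) + \<epsilon>"
      using approximate_cstar[OF x] by blast
    have "(qn x)\<^sup>2 \<le> (N (x + k))\<^sup>2"
      using x k by (intro power_mono qn_le qn_nonneg)
    with k show "(qn x)\<^sup>2 \<le> N (adj x * x + h) + \<epsilon>"
      by simp
  qed
qed

lemma pre_cstar_algebra_on_quotient:
  "pre_cstar_algebra_on (quot_carrier R J) (quot_lift2 J (+)) J (\<lambda>c. quot_lift J (scale c))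
     (quot_lift2 J (*)) (quot_lift J adj) (quot_norm N)"
proof (intro pre_cstar_algebra_on.intro star_algebra_on_quotient)
  show "pre_cstar_algebra_on_axioms (quot_carrier R J) (quot_lift2 J (+)) J
      (\<lambda>c. quot_lift J (scale c)) (quot_lift2 J (*)) (quot_lift J adj) (quot_norm N)"
  proof (unfold_locales, goal_cases)
    case (2 X)
    then obtain x where "x \<in> R" "X = x +o J"
      by (auto elim: quot_carrierE)
    then show ?case
      using qn_eq_zero[of x] by (simp add: coset_eq_ideal flip: qn_def)
  qed (auto elim!: quot_carrierE simp: coset_simps carrier_closed qn_nonneg qn_triangle qn_scale
      qn_mult qn_cstar simp flip: qn_def)
qed

end

section \<open>Absolutely summable power series\<close>

lemma abs_power_seriesI:
  "(\<And>n. fps_nth F n \<in> I) \<Longrightarrow> summable (\<lambda>n. norm (fps_nth F n)) \<Longrightarrow> F \<in> abs_power_series I"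
  by (simp add: abs_power_series_def)

lemma abs_power_series_nth: "F \<in> abs_power_series I \<Longrightarrow> fps_nth F n \<in> I"
  by (simp add: abs_power_series_def)

lemma abs_power_series_summable:
  "F \<in> abs_power_series I \<Longrightarrow> summable (\<lambda>n. norm (fps_nth F n))"
  by (simp add: abs_power_series_def)

lemma abs_power_series_mono: "I \<subseteq> I' \<Longrightarrow> abs_power_series I \<subseteq> abs_power_series I'"
  by (auto simp: abs_power_series_def)

lemma closed_ideal_UNIV: "closed_ideal UNIV"
  by (simp add: closed_ideal_def)

context
  fixes I :: "'a::cstar_algebra set"
  assumes I: "closed_ideal I"
begin

lemma abs_power_series_zero: "0 \<in> abs_power_series I"
  using closed_idealD(2)[OF I] by (simp add: abs_power_series_def)

lemma abs_power_series_add: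
  assumes "F \<in> abs_power_series I" "G \<in> abs_power_series I"
  shows "F + G \<in> abs_power_series I"
proof (rule abs_power_seriesI)
  show "summable (\<lambda>n. norm (fps_nth (F + G) n))"
    using summable_add[OF assms[THEN abs_power_series_summable]]
    by (rule summable_comparison_test'[where N=0]) (simp add: norm_triangle_ineq)
qed (use assms in \<open>simp add: abs_power_series_nth closed_idealD(3)[OF I]\<close>)

lemma abs_power_series_scaleC:
  assumes "F \<in> abs_power_series I"
  shows "fps_scaleC c F \<in> abs_power_series I"
  using assms closed_idealD(4)[OF I]
  by (auto simp: abs_power_series_def fps_scaleC_def norm_scaleC intro: summable_mult)

lemma abs_power_series_star:
  assumes "F \<in> abs_power_series I"
  shows "fps_star F \<in> abs_power_series I"
  using assms closed_ideal_star[OF I]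
  by (auto simp: abs_power_series_def fps_star_def norm_star)

end

lemma summable_norm_fps_mult:
  fixes F G :: "'a::cstar_algebra fps"
  assumes "summable (\<lambda>n. norm (fps_nth F n))" "summable (\<lambda>n. norm (fps_nth G n))"
  shows "summable (\<lambda>n. norm (fps_nth (F * G) n))"
proof (rule summable_comparison_test'[where N=0])
  show "summable (\<lambda>n. \<Sum>i\<le>n. norm (fps_nth F i) * norm (fps_nth G (n - i)))"
    using assms by (intro summable_Cauchy_product) simp_all
  show "norm (norm (fps_nth (F * G) n)) \<le> (\<Sum>i\<le>n. norm (fps_nth F i) * norm (fps_nth G (n - i)))" for n
    by (auto simp: fps_mult_nth atLeast0AtMost intro!: sum_norm_le norm_mult_ineq)
qed

lemma abs_power_series_mult_left:
  assumes I: "closed_ideal I" and "F \<in> abs_power_series UNIV" "G \<in> abs_power_series I"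
  shows "F * G \<in> abs_power_series I"
  using assms by (intro abs_power_seriesI summable_norm_fps_mult)
    (auto simp: fps_mult_nth abs_power_series_def intro!: closed_ideal_sum[OF I] closed_idealD(5)[OF I])

lemma abs_power_series_mult_right:
  assumes I: "closed_ideal I" and "F \<in> abs_power_series UNIV" "G \<in> abs_power_series I"
  shows "G * F \<in> abs_power_series I"
  using assms by (intro abs_power_seriesI summable_norm_fps_mult)
    (auto simp: fps_mult_nth abs_power_series_def intro!: closed_ideal_sum[OF I] closed_idealD(6)[OF I])

section \<open>Evaluation of series at points of [-1, 1]\<close>

lemma summable_norm_fps_value:
  fixes F :: "'a::cstar_algebra fps"
  assumes "F \<in> abs_power_series UNIV" "\<bar>t\<bar> \<le> 1"
  shows "summable (\<lambda>n. norm (t ^ n *\<^sub>R fps_nth F n))"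
proof (rule summable_comparison_test'[where N=0])
  show "norm (norm (t ^ n *\<^sub>R fps_nth F n)) \<le> norm (fps_nth F n)" for n
    using assms(2) by (simp add: power_abs power_le_one mult_left_le_one_le)
qed (use assms abs_power_series_summable in blast)

lemma fps_value_sums:
  assumes "F \<in> abs_power_series UNIV" "\<bar>t\<bar> \<le> 1"
  shows "(\<lambda>n. t ^ n *\<^sub>R fps_nth F n) sums fps_value F t"
  unfolding fps_value_def
  using summable_norm_fps_value[OF assms] by (rule summable_sums[OF summable_norm_cancel])

lemma norm_fps_value_le:
  assumes "F \<in> abs_power_series UNIV" "\<bar>t\<bar> \<le> 1"
  shows "norm (fps_value F t) \<le> (\<Sum>n. norm (fps_nth F n))"
proof -
  have "norm (fps_value F t) \<le> (\<Sum>n. norm (t ^ n *\<^sub>R fps_nth F n))"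
    unfolding fps_value_def by (rule summable_norm[OF summable_norm_fps_value[OF assms]])
  also have "\<dots> \<le> (\<Sum>n. norm (fps_nth F n))"
    using assms(2)
    by (intro suminf_le summable_norm_fps_value assms abs_power_series_summable[OF assms(1)])
      (simp add: power_abs power_le_one mult_left_le_one_le)
  finally show ?thesis .
qed

lemma fps_value_add:
  assumes "F \<in> abs_power_series UNIV" "G \<in> abs_power_series UNIV" "\<bar>t\<bar> \<le> 1"
  shows "fps_value (F + G) t = fps_value F t + fps_value G t"
  using sums_add[OF fps_value_sums[OF assms(1,3)] fps_value_sums[OF assms(2,3)]]
  by (simp add: fps_value_def sums_iff scaleR_add_right)

lemma fps_value_scaleC:
  assumes "F \<in> abs_power_series UNIV" "\<bar>t\<bar> \<le> 1"
  shows "fps_value (fps_scaleC c F) t = c *\<^sub>C fps_value F t"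
  using bounded_linear.sums[OF bounded_linear_scaleC fps_value_sums[OF assms], of c]
  by (simp add: fps_value_def sums_iff fps_scaleC_def
      linear_cmul[OF bounded_linear.linear[OF bounded_linear_scaleC]])

lemma fps_value_star:
  assumes "F \<in> abs_power_series UNIV" "\<bar>t\<bar> \<le> 1"
  shows "fps_value (fps_star F) t = star (fps_value F t)"
  using bounded_linear.sums[OF bounded_linear_star fps_value_sums[OF assms]]
  by (simp add: fps_value_def sums_iff fps_star_def star_scaleR)

lemma fps_value_mult:
  assumes "F \<in> abs_power_series UNIV" "G \<in> abs_power_series UNIV" "\<bar>t\<bar> \<le> 1"
  shows "fps_value (F * G) t = fps_value F t * fps_value G t"
proof -
  have "(\<Sum>i\<le>n. (t ^ i *\<^sub>R fps_nth F i) * (t ^ (n - i) *\<^sub>R fps_nth G (n - i))) = t ^ n *\<^sub>R fps_nth (F * G) n" for n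
    by (auto simp: fps_mult_nth atLeast0AtMost scaleR_sum_right simp flip: power_add intro!: sum.cong)
  then show ?thesis
    using Cauchy_product[OF summable_norm_fps_value[OF assms(1,3)] summable_norm_fps_value[OF assms(2,3)]]
    by (simp add: fps_value_def)
qed

lemma fps_value_mult_const:
  assumes "F \<in> abs_power_series UNIV" "\<bar>t\<bar> \<le> 1"
  shows "fps_value (F * fps_const a) t = fps_value F t * a"
  using sums_mult2[OF fps_value_sums[OF assms], of a] by (simp add: fps_value_def sums_iff)

text \<open>The partial sums lie in \<open>I\<close>, and \<open>I\<close> is closed.\<close>

lemma fps_value_in_ideal:
  assumes I: "closed_ideal I" and F: "F \<in> abs_power_series I" and t: "\<bar>t\<bar> \<le> 1"
  shows "fps_value F t \<in> I"
proof (rule closed_sequentially[OF closed_idealD(1)[OF I]])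
  have "F \<in> abs_power_series UNIV"
    using F abs_power_series_mono by blast
  then show "(\<lambda>N. \<Sum>n<N. t ^ n *\<^sub>R fps_nth F n) \<longlonglongrightarrow> fps_value F t"
    using fps_value_sums[OF _ t] by (simp add: sums_def)
  show "(\<Sum>n<N. t ^ n *\<^sub>R fps_nth F n) \<in> I" for N
    by (intro closed_ideal_sum[OF I] closed_ideal_scaleR[OF I] abs_power_series_nth[OF F])
qed

section \<open>Recovering coefficients from values near 0\<close>

lemma abs_power_series_shift: "F \<in> abs_power_series I \<Longrightarrow> fps_shift 1 F \<in> abs_power_series I"
  using summable_ignore_initial_segment[of "\<lambda>n. norm (fps_nth F n)" 1]
  by (simp add: abs_power_series_def)

text \<open>Splits off the constant term. The factor \<open>t\<close> makes the remainder vanish in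
  the limit at 0, and dividing by it leads to the next coefficient.\<close>

lemma fps_value_shift:
  assumes "F \<in> abs_power_series UNIV" "\<bar>t\<bar> \<le> 1"
  shows "fps_value F t = fps_nth F 0 + t *\<^sub>R fps_value (fps_shift 1 F) t"
proof -
  have "(\<lambda>n. t *\<^sub>R (t ^ n *\<^sub>R fps_nth (fps_shift 1 F) n)) sums (t *\<^sub>R fps_value (fps_shift 1 F) t)"
    by (intro sums_scaleR_right fps_value_sums abs_power_series_shift assms)
  then have "(\<lambda>n. t ^ Suc n *\<^sub>R fps_nth F (Suc n)) sums (t *\<^sub>R fps_value (fps_shift 1 F) t)"
    by simp
  then have "(\<lambda>n. t ^ n *\<^sub>R fps_nth F n) sums (t *\<^sub>R fps_value (fps_shift 1 F) t + fps_nth F 0)"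
    by (subst (asm) sums_Suc_iff) simp
  then show ?thesis
    by (simp add: fps_value_def sums_iff add.commute)
qed

text \<open>The coefficients are recovered one by one, as limits of values at points tending to \<open>0\<close>.\<close>

lemma coefficients_in_ideal:
  fixes F :: "'a::cstar_algebra fps"
  assumes I: "closed_ideal I" and K: "K \<subseteq> {-1..1}" "0 islimpt K"
    and "F \<in> abs_power_series UNIV" "\<And>t. t \<in> K \<Longrightarrow> t \<noteq> 0 \<Longrightarrow> fps_value F t \<in> I"
  shows "fps_nth F n \<in> I"
  using assms(4,5)
proof (induction n arbitrary: F)
  have head: "fps_nth F 0 \<in> I"
    if F: "F \<in> abs_power_series UNIV" "\<And>t. t \<in> K \<Longrightarrow> t \<noteq> 0 \<Longrightarrow> fps_value F t \<in> I" for F :: "'a fps"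
  proof -
    obtain t where t: "\<And>k. t k \<in> K - {0}" "t \<longlonglongrightarrow> 0"
      using K(2) by (auto simp: islimpt_sequential)
    have t1: "\<bar>t k\<bar> \<le> 1" for k
      using t(1)[of k] K(1) by (auto simp: abs_le_iff)
    let ?M = "\<Sum>n. norm (fps_nth (fps_shift 1 F) n)"
    \<comment> \<open>The difference is \<open>t k\<close> times a value of the shifted series, and
      these values are bounded by \<open>?M\<close>.\<close>
    have "(\<lambda>k. fps_value F (t k) - fps_nth F 0) \<longlonglongrightarrow> 0"
    proof (rule Lim_null_comparison)
      show "\<forall>\<^sub>F k in sequentially. norm (fps_value F (t k) - fps_nth F 0) \<le> \<bar>t k\<bar> * ?M"
        using norm_fps_value_le[OF abs_power_series_shift[OF F(1)] t1]
        by (intro always_eventually allI) (simp add: fps_value_shift[OF F(1) t1] mult_left_mono)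
      show "(\<lambda>k. \<bar>t k\<bar> * ?M) \<longlonglongrightarrow> 0"
        using tendsto_mult_left_zero[OF tendsto_rabs_zero[OF t(2)]] by simp
    qed
    then have "(\<lambda>k. fps_value F (t k)) \<longlonglongrightarrow> fps_nth F 0"
      by (simp add: LIM_zero_iff)
    then show ?thesis
      using closed_sequentially[OF closed_idealD(1)[OF I], of "\<lambda>k. fps_value F (t k)"] F(2) t(1) by blast
  qed
  case 0
  then show ?case
    using head by blast
  case (Suc n)
  \<comment> \<open>The shifted series inherits the assumption because t can be divided out; this is
    why the induction speaks of nonzero points only.\<close>
  have "fps_value (fps_shift 1 F) t \<in> I" if t: "t \<in> K" "t \<noteq> 0" for t
  proof -
    have "\<bar>t\<bar> \<le> 1"
      using t K(1) by (auto simp: abs_le_iff)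
    then have "fps_value (fps_shift 1 F) t = (1 / t) *\<^sub>R (fps_value F t - fps_nth F 0)"
      using t Suc.prems(1) by (simp add: fps_value_shift)
    then show ?thesis
      using Suc.prems t head[OF Suc.prems] by (simp add: closed_ideal_scaleR[OF I] closed_ideal_diff[OF I])
  qed
  then have "fps_nth (fps_shift 1 F) n \<in> I"
    by (intro Suc.IH abs_power_series_shift Suc.prems)
  then show ?case
    by simp
qed

lemma norm_fps_value_le_norm_on:
  assumes "K \<subseteq> {-1..1}" "F \<in> abs_power_series UNIV" "t \<in> K"
  shows "norm (fps_value F t) \<le> fps_norm_on K F"
  unfolding fps_norm_on_def
proof (rule cSUP_upper[OF assms(3)])
  have "\<bar>s\<bar> \<le> 1" if "s \<in> K" for s
    using that assms(1) by (auto simp: abs_le_iff)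
  \<comment> \<open>Boundedness by the sum of the coefficient norms is what makes the real supremum
    meaningful.\<close>
  then show "bdd_above ((\<lambda>t. norm (fps_value F t)) ` K)"
    using norm_fps_value_le[OF assms(2)] by (auto intro!: bdd_aboveI)
qed

lemma fps_norm_on_le:
  "K \<noteq> {} \<Longrightarrow> (\<And>t. t \<in> K \<Longrightarrow> norm (fps_value F t) \<le> c) \<Longrightarrow> fps_norm_on K F \<le> c"
  unfolding fps_norm_on_def by (rule cSUP_least)

text \<open>All but finitely many coefficients are absorbed by the tail of the series.\<close>

lemma approximate_unit_series:
  assumes I: "closed_ideal I" and H: "H \<in> abs_power_series I" and eps: "0 < \<epsilon>"
  obtains e where "e \<in> I" "\<And>x. norm (x - x * e) \<le> norm x"
    "(\<Sum>n. norm (fps_nth (H - H * fps_const e) n)) < \<epsilon>"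
proof -
  let ?a = "\<lambda>n. norm (fps_nth H n)"
  have sm: "summable ?a"
    using H by (rule abs_power_series_summable)
  obtain M where M: "norm (\<Sum>n. ?a (n + M)) < \<epsilon> / 2"
    using suminf_exist_split[OF _ sm, of "\<epsilon>/2"] eps by auto
  \<comment> \<open>The first M coefficients together contribute at most M \<delta> \<le>
    \<epsilon>/2; the summand 1 covers M = 0.\<close>
  define \<delta> where "\<delta> = \<epsilon> / (2 * (real M + 1))"
  have "0 < \<delta>"
    using eps by (simp add: \<delta>_def)
  then obtain e where e: "e \<in> I" "\<And>x. norm (x - x * e) \<le> norm x"
    "\<And>h. h \<in> fps_nth H ` {..<M} \<Longrightarrow> norm (h - h * e) < \<delta>"
    using approximate_unit_finite[OF I, of "fps_nth H ` {..<M}" \<delta>] abs_power_series_nth[OF H] by blast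
  let ?b = "\<lambda>n. norm (fps_nth H n - fps_nth H n * e)"
  have smb: "summable ?b"
    by (rule summable_comparison_test'[OF sm, where N=0]) (simp add: e(2))
  have "(\<Sum>n. ?b n) = (\<Sum>n. ?b (n + M)) + (\<Sum>n<M. ?b n)"
    by (rule suminf_split_initial_segment[OF smb])
  \<comment> \<open>The tail was cut before \<open>e\<close> was chosen; contractivity keeps it
    small for every such \<open>e\<close>.\<close>
  also have "(\<Sum>n. ?b (n + M)) \<le> (\<Sum>n. ?a (n + M))"
    by (intro suminf_le summable_ignore_initial_segment sm smb e(2))
  also have "(\<Sum>n. ?a (n + M)) < \<epsilon> / 2"
    using M by simp
  also have "(\<Sum>n<M. ?b n) \<le> real M * \<delta>"
    using sum_bounded_above[of "{..<M}" ?b \<delta>] e(3) by (simp add: less_imp_le)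
  also have "real M * \<delta> \<le> \<epsilon> / 2"
    using eps by (simp add: \<delta>_def field_simps)
  finally have "(\<Sum>n. ?b n) < \<epsilon>"
    by simp
  with e(1,2) that show thesis
    by simp
qed

text \<open>Beyond coefficientwise computation, this rests on absolute summability of Cauchy
  products and on self-adjointness of \<open>I\<close>, which makes \<open>fps_star\<close> preserve
  the ideal.\<close>

lemma star_ideal_on_abs_power_series:
  fixes I :: "'a::cstar_algebra set"
  assumes I: "closed_ideal I"
  shows "star_ideal_on (abs_power_series UNIV) fps_scaleC fps_star (abs_power_series I)"
proof (intro star_ideal_on.intro star_ideal_on_axioms.intro star_algebra_on.intro, goal_cases)
  case (2)
  show ?case
    by (intro abs_power_series_zero closed_ideal_UNIV)
next
  case (9 F)
  have "- F \<in> abs_power_series UNIV"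
    using 9 by (simp add: abs_power_series_def)
  then show ?case
    by (intro bexI[of _ "- F"]) auto
next
  case (13 F)
  show ?case
    by (rule fps_ext) (simp add: fps_scaleC_def scaleC_one)
next
  case (17 F G c)
  show ?case
    by (rule fps_ext) (simp add: fps_scaleC_def fps_mult_nth mult_scaleC_left scaleC_sum)
next
  case (18 F G c)
  show ?case
    by (rule fps_ext) (simp add: fps_scaleC_def fps_mult_nth mult_scaleC_right scaleC_sum)
next
  case (21 F G)
  show ?case
  proof (rule fps_ext)
    fix n
    have "fps_nth (fps_star (F * G)) n = (\<Sum>i=0..n. star (fps_nth G (n - i)) * star (fps_nth F i))"
      by (simp add: fps_star_def fps_mult_nth star_sum star_mult)
    also have "\<dots> = (\<Sum>i=0..n. star (fps_nth G i) * star (fps_nth F (n - i)))"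
      by (rule sum.reindex_bij_witness[of _ "\<lambda>i. n - i" "\<lambda>i. n - i"]) auto
    finally show "fps_nth (fps_star (F * G)) n = fps_nth (fps_star G * fps_star F) n"
      by (simp add: fps_star_def fps_mult_nth)
  qed
next
  case 23
  show ?case
    by (intro abs_power_series_mono) simp
next
  case 24
  show ?case
    by (rule abs_power_series_zero[OF I])
qed ((simp add: algebra_simps; fail)
    | (rule abs_power_series_add abs_power_series_scaleC abs_power_series_star
        abs_power_series_mult_left abs_power_series_mult_right; (assumption | rule I closed_ideal_UNIV))
    | (rule fps_ext, simp add: fps_scaleC_def fps_star_def scaleC_add_right scaleC_add_left
        scaleC_scaleC star_add star_scaleC star_star; fail))+

section \<open>The supremum norm on \<open>K\<close> and its approximate C*-identity\<close>

context
  fixes K :: "real set" and I :: "'a::cstar_algebra set"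
  assumes I: "closed_ideal I" and K: "K \<subseteq> {-1..1}" "0 islimpt K"
begin

lemma abs_le_one: "t \<in> K \<Longrightarrow> \<bar>t\<bar> \<le> 1"
  using K(1) by (auto simp: abs_le_iff)

lemma K_nonempty: "K \<noteq> {}"
  using K(2) by auto

lemma fps_norm_on_nonneg: "F \<in> abs_power_series UNIV \<Longrightarrow> 0 \<le> fps_norm_on K F"
  using K_nonempty norm_fps_value_le_norm_on[OF K(1)] by (meson ex_in_conv norm_ge_zero order_trans)

lemma fps_norm_on_scaleC_le:
  assumes F: "F \<in> abs_power_series UNIV"
  shows "fps_norm_on K (fps_scaleC c F) \<le> cmod c * fps_norm_on K F"
  using norm_fps_value_le_norm_on[OF K(1) F]
  by (intro fps_norm_on_le K_nonempty) (simp add: fps_value_scaleC F abs_le_one norm_scaleC mult_left_mono)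

lemma fps_norm_on_scaleC:
  assumes F: "F \<in> abs_power_series UNIV"
  shows "fps_norm_on K (fps_scaleC c F) = cmod c * fps_norm_on K F"
proof (cases "c = 0")
  case True
  then show ?thesis
    using fps_norm_on_scaleC_le[OF F, of c] fps_norm_on_nonneg[OF abs_power_series_scaleC[OF closed_ideal_UNIV F], of c]
    by simp
next
  case False
  have cF: "fps_scaleC c F \<in> abs_power_series UNIV"
    by (rule abs_power_series_scaleC[OF closed_ideal_UNIV F])
  have "cmod c * norm (fps_value F t) \<le> fps_norm_on K (fps_scaleC c F)" if "t \<in> K" for t
    using norm_fps_value_le_norm_on[OF K(1) cF that] that
    by (simp add: fps_value_scaleC F abs_le_one norm_scaleC)
  then have "fps_norm_on K F \<le> fps_norm_on K (fps_scaleC c F) / cmod c"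
    using False by (intro fps_norm_on_le K_nonempty) (simp add: pos_le_divide_eq mult.commute)
  then show ?thesis
    using fps_norm_on_scaleC_le[OF F, of c] False by (simp add: pos_le_divide_eq mult.commute)
qed

text \<open>The witness is -F e, so that F + G = F(1 - e). The element \<open>e\<close> depends on
  \<open>H\<close> and \<open>\<epsilon>\<close> but not on the point t, hence the pointwise
  C*-estimate passes to the supremum.\<close>

lemma fps_norm_on_approximate_cstar:
  assumes F: "F \<in> abs_power_series UNIV" and H: "H \<in> abs_power_series I" and eps: "0 < \<epsilon>"
  shows "\<exists>G\<in>abs_power_series I. (fps_norm_on K (F + G))\<^sup>2 \<le> fps_norm_on K (fps_star F * F + H) + \<epsilon>"
proof -
  interpret star_ideal_on "abs_power_series UNIV" fps_scaleC fps_star "abs_power_series I"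
    by (rule star_ideal_on_abs_power_series[OF I])
  obtain e where e: "e \<in> I" "\<And>x. norm (x - x * e) \<le> norm x"
    "(\<Sum>n. norm (fps_nth (H - H * fps_const e) n)) < \<epsilon>"
    using approximate_unit_series[OF I H eps] by blast
  have const: "fps_const e \<in> abs_power_series I"
    using e(1) closed_idealD(2)[OF I]
    by (auto simp: abs_power_series_def fps_const_def intro!: summable_finite[of "{0}"] split: if_splits)
  have Fe: "F * fps_const e \<in> abs_power_series I"
    by (rule abs_power_series_mult_left[OF I F const])
  let ?G = "- (F * fps_const e)"
  let ?P = "fps_star F * F"
  have G: "?G \<in> abs_power_series I"
    by (rule ideal_uminus[OF Fe])
  have H': "H \<in> abs_power_series UNIV"
    by (rule in_carrier[OF H])
  have P: "?P \<in> abs_power_series UNIV"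
    by (intro mult_closed adj_closed F)
  have He: "- (H * fps_const e) \<in> abs_power_series UNIV"
    by (intro in_carrier ideal_uminus ideal_mult_right H const)
  have neg: "fps_value (- L) t = - fps_value L t" if "L \<in> abs_power_series UNIV" "t \<in> K" for L :: "'a fps" and t
    using fps_value_scaleC[OF that(1) abs_le_one[OF that(2)], of "-1"] that
    by (simp add: scale_minus_one[OF that(1)] scaleC_minus_one)
  have diff: "fps_value (L + - (L * fps_const e)) t = fps_value L t - fps_value L t * e"
    if L: "L \<in> abs_power_series UNIV" and t: "t \<in> K" for L :: "'a fps" and t
  proof -
    have "L * fps_const e \<in> abs_power_series UNIV"
      by (rule in_carrier[OF abs_power_series_mult_left[OF I L const]])
    moreover from this have "- (L * fps_const e) \<in> abs_power_series UNIV"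
      by (simp add: abs_power_series_def)
    ultimately show ?thesis
      using t L by (simp only: fps_value_add abs_le_one neg fps_value_mult_const) simp
  qed
  have pointwise: "(norm (fps_value (F + ?G) t))\<^sup>2 \<le> fps_norm_on K (?P + H) + \<epsilon>" if t: "t \<in> K" for t
  proof -
    let ?x = "fps_value F t" and ?p = "fps_value ?P t" and ?h = "fps_value H t"
    have "(norm (fps_value (F + ?G) t))\<^sup>2 = (norm (?x - ?x * e))\<^sup>2"
      by (simp only: diff[OF F t])
    also have "\<dots> \<le> norm (star ?x * ?x - star ?x * ?x * e)"
      by (rule norm_sandwich_le[OF e(2)])
    also have "star ?x * ?x = ?p"
      using fps_value_mult[OF adj_closed[OF F] F abs_le_one[OF t]] fps_value_star[OF F abs_le_one[OF t]]
      by simp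
    \<comment> \<open>Adding and subtracting the value of \<open>H\<close> separates a term on which
      1 - e acts as a contraction from one which it makes small.\<close>
    also have "?p - ?p * e = ((?p + ?h) - (?p + ?h) * e) - (?h - ?h * e)"
      by (simp add: algebra_simps)
    also have "norm \<dots> \<le> norm (?p + ?h) + norm (?h - ?h * e)"
      by (rule order_trans[OF norm_triangle_ineq4 add_right_mono[OF e(2)]])
    also have "norm (?p + ?h) \<le> fps_norm_on K (?P + H)"
      using norm_fps_value_le_norm_on[OF K(1) add_closed[OF P H'] t]
      by (simp add: fps_value_add[OF P H' abs_le_one[OF t]])
    also have "norm (?h - ?h * e) \<le> \<epsilon>"
      using norm_fps_value_le[OF add_closed[OF H' He] abs_le_one[OF t]] e(3)
      by (simp only: diff[OF H' t]) simp
    finally show ?thesis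
      by simp
  qed
  \<comment> \<open>The square root is taken before the supremum and undone afterwards, so that no
    supremum of squares appears.\<close>
  have "fps_norm_on K (F + ?G) \<le> sqrt (fps_norm_on K (?P + H) + \<epsilon>)"
    by (intro fps_norm_on_le K_nonempty real_le_rsqrt pointwise)
  then have "(fps_norm_on K (F + ?G))\<^sup>2 \<le> (sqrt (fps_norm_on K (?P + H) + \<epsilon>))\<^sup>2"
    by (intro power_mono fps_norm_on_nonneg add_ideal_closed F G)
  also have "\<dots> = fps_norm_on K (?P + H) + \<epsilon>"
    using fps_norm_on_nonneg[OF add_closed[OF P H']] eps by simp
  finally show ?thesis
    using G by blast
qed

text \<open>For t in \<open>K\<close>, the values of -H at t lie in \<open>I\<close> and approximate
  F(t). So F(t) is in \<open>I\<close>, and the limit point 0 of \<open>K\<close> carries this over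
  to the coefficients.\<close>

lemma abs_power_series_closed:
  assumes F: "F \<in> abs_power_series UNIV"
    and approx: "\<And>\<epsilon>. 0 < \<epsilon> \<Longrightarrow> \<exists>H\<in>abs_power_series I. fps_norm_on K (F + H) < \<epsilon>"
  shows "F \<in> abs_power_series I"
proof (rule abs_power_seriesI)
  interpret star_ideal_on "abs_power_series UNIV" fps_scaleC fps_star "abs_power_series I"
    by (rule star_ideal_on_abs_power_series[OF I])
  have "fps_value F t \<in> I" if t: "t \<in> K" for t
  proof -
    have "fps_value F t \<in> closure I"
      unfolding closure_approachable
    proof (intro allI impI)
      fix \<epsilon> :: real assume "0 < \<epsilon>"
      from approx[OF this] obtain H where H: "H \<in> abs_power_series I" "fps_norm_on K (F + H) < \<epsilon>"
        by blast
      have "norm (fps_value F t + fps_value H t) < \<epsilon>"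
        using norm_fps_value_le_norm_on[OF K(1) add_ideal_closed[OF F H(1)] t] H
        by (simp add: fps_value_add[OF F in_carrier[OF H(1)] abs_le_one[OF t]])
      moreover have "(-1) *\<^sub>R fps_value H t \<in> I"
        by (intro closed_ideal_scaleR[OF I] fps_value_in_ideal[OF I H(1)] abs_le_one t)
      ultimately show "\<exists>y\<in>I. dist y (fps_value F t) < \<epsilon>"
        by (intro bexI[of _ "(-1) *\<^sub>R fps_value H t"])
          (simp_all add: dist_norm norm_minus_commute[of "- fps_value H t"])
    qed
    then show ?thesis
      using closed_idealD(1)[OF I] by (simp add: closure_closed)
  qed
  then show "fps_nth F n \<in> I" for n
    by (intro coefficients_in_ideal[OF I K F])
qed (rule abs_power_series_summable[OF F])

text \<open>The seminorm properties are inherited pointwise from the norm of the algebra; closedness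
  and the approximate C*-identity are the two preceding results.\<close>

lemma cstar_seminorm_ideal_abs_power_series:
  "cstar_seminorm_ideal (abs_power_series UNIV) fps_scaleC fps_star (abs_power_series I) (fps_norm_on K)"
proof (intro cstar_seminorm_ideal.intro star_ideal_on_abs_power_series I cstar_seminorm_ideal_axioms.intro, goal_cases)
  case (1 F)
  then show ?case
    by (rule fps_norm_on_nonneg)
next
  case (2 F G)
  then show ?case
    using norm_fps_value_le_norm_on[OF K(1)]
    by (intro fps_norm_on_le K_nonempty)
      (auto simp: fps_value_add abs_le_one intro!: order_trans[OF norm_triangle_ineq] add_mono)
next
  case (3 F c)
  then show ?case
    by (rule fps_norm_on_scaleC)
next
  case (4 F G)
  then show ?case
    using norm_fps_value_le_norm_on[OF K(1)]
    by (intro fps_norm_on_le K_nonempty)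
      (auto simp: fps_value_mult abs_le_one fps_norm_on_nonneg
        intro!: order_trans[OF norm_mult_ineq] mult_mono)
next
  case (5 F)
  then show ?case
    unfolding fps_norm_on_def by (intro SUP_cong) (simp_all add: fps_value_star abs_le_one norm_star)
next
  case (6 F)
  then show ?case
    by (rule abs_power_series_closed)
next
  case (7 F H \<epsilon>)
  then show ?case
    by (rule fps_norm_on_approximate_cstar)
qed

end

theorem theorem3:
  fixes K :: "real set" and I :: "'a::cstar_algebra set"
  assumes "K \<subseteq> {-1..1}" and "0 islimpt K"
    and "closed_ideal I"
  shows "pre_cstar_algebra_on
           (quot_carrier (abs_power_series UNIV) (abs_power_series I))
           (quot_lift2 (abs_power_series I) (+))
           (abs_power_series I)
           (\<lambda>c. quot_lift (abs_power_series I) (fps_scaleC c))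
           (quot_lift2 (abs_power_series I) (*))
           (quot_lift (abs_power_series I) fps_star)
           (quot_norm (fps_norm_on K))"
proof -
  interpret cstar_seminorm_ideal "abs_power_series UNIV" fps_scaleC fps_star "abs_power_series I" "fps_norm_on K"
    by (rule cstar_seminorm_ideal_abs_power_series[OF assms(3,1,2)])
  show ?thesis
    by (rule pre_cstar_algebra_on_quotient)
qed

end
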